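(* If $G$ is a graph with $\delta(G) \ge 300\,\alpha(G)$, then $G$ contains a cycle of length $\ell$ for every integer $\ell$ with $3 \le \ell \le \delta(G)/81$.
   Context: Graphs are finite, simple and undirected, with nonempty vertex set. $\delta(G)$ is the minimum degree of $G$. $\alpha(G)$ is the independence number, i.e. the size of the largest subset of the vertex set that does not contain an edge. *)

theory Defs
  imports Complex_Main "Graph_Theory.Pair_Digraph"
begin

text \<open>
  A finite simple undirected graph is a \<^locale>\<open>pair_graph\<close>: a finite vertex set with a symmetric
  irreflexive relation on it, so the edge \<open>{u, v}\<close> is represented by both arcs \<open>(u, v)\<close> and
  \<open>(v, u)\<close>. This has two consequences. The degree of a vertex is its out-degree. A cycle of the
  digraph is a cycle of the undirected graph only when its length is at least 3, because
  \<open>u, v, u\<close> counts as a cycle of length 2.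
\<close>

definition min_degree :: "'a pair_pre_digraph \<Rightarrow> nat" where
  "min_degree G = Min (out_degree (with_proj G) ` pverts G)"

definition independent_set :: "'a pair_pre_digraph \<Rightarrow> 'a set \<Rightarrow> bool" where
  "independent_set G S \<longleftrightarrow> S \<subseteq> pverts G \<and> (\<forall>u\<in>S. \<forall>v\<in>S. (u, v) \<notin> parcs G)"

definition independence_number :: "'a pair_pre_digraph \<Rightarrow> nat" where
  "independence_number G = Max (card ` {S. independent_set G S})"

end

theory Submission
  imports Defs
begin

text \<open>
  Let \<open>L 0, L 1, \<dots>\<close> be the breadth-first levels of a vertex and \<open>a\<close> the independence number. Take the
  first \<open>i \<ge> 1\<close> such that \<open>L i\<close> has more than \<open>(l + 5) * a\<close> vertices or \<open>L (i + 1)\<close> is less than twice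
  as large as \<open>L i\<close>. Since \<open>L 1\<close> has at least \<open>300 * a\<close> vertices and the sizes double before \<open>i\<close>, the
  index \<open>i\<close> is far below \<open>l / 2\<close>. In the first case a minimal \<open>H \<subseteq> L i\<close> with more than
  \<open>(l + 5) * \<alpha>(H)\<close> vertices is connected, not bipartite and of large minimum degree. In the second case
  the edges at \<open>L i\<close> stay among \<open>O(|L i|)\<close> vertices, which yields a pair \<open>X \<subseteq> L j\<close>,
  \<open>Y \<subseteq> L j \<union> L (j + 1)\<close> with large minimum degree between \<open>X\<close> and \<open>Y\<close>, where \<open>j \<le> i\<close>.

  Descending the search tree until it separates \<open>H\<close> (or \<open>X\<close>) splits that set into classes \<open>A\<close> and \<open>B\<close>
  such that any two vertices of different classes are joined through the tree by a path of the same
  length \<open>2 * h\<close>, so it remains to find a path of length exactly \<open>l - 2 * h\<close> from \<open>A\<close> to \<open>B\<close>. Some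
  vertex \<open>y\<close> has neighbours in both classes; a greedy path that starts next to \<open>y\<close> ends in one of them,
  and prolonging it through \<open>y\<close> to the other class gives the required path. In the second case half of
  the lengths have the wrong parity, which is corrected by an edge inside the neighbourhood of \<open>y\<close>.
\<close>

section \<open>Graphs as adjacency predicates\<close>

locale adjacency_graph =
  fixes V :: "'a set" and adj :: "'a \<Rightarrow> 'a \<Rightarrow> bool"
  assumes finite_V: "finite V"
    and adj_V: "adj x y \<Longrightarrow> x \<in> V"
    and adj_sym: "adj x y \<Longrightarrow> adj y x"
    and adj_irrefl: "\<not> adj x x"
begin

definition nbrs :: "'a set \<Rightarrow> 'a \<Rightarrow> 'a set" where
  "nbrs S x = {y \<in> S. adj x y}"

definition indep :: "'a set \<Rightarrow> bool" where
  "indep I \<longleftrightarrow> (\<forall>u\<in>I. \<forall>v\<in>I. \<not> adj u v)"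

definition alpha :: "'a set \<Rightarrow> nat" where
  "alpha S = Max (card ` {I. I \<subseteq> S \<and> indep I})"

definition path :: "'a set \<Rightarrow> 'a list \<Rightarrow> bool" where
  "path S xs \<longleftrightarrow> xs \<noteq> [] \<and> set xs \<subseteq> S \<and> distinct xs \<and> successively adj xs"

text \<open>\<open>t\<close> counts edges, so the vertex list has \<open>Suc t\<close>
  entries.\<close>

definition joined :: "'a set \<Rightarrow> 'a set \<Rightarrow> 'a set \<Rightarrow> nat \<Rightarrow> bool" where
  "joined S A B t \<longleftrightarrow> (\<exists>xs. path S xs \<and> hd xs \<in> A \<and> last xs \<in> B \<and> length xs = Suc t)"

text \<open>A list of two adjacent vertices satisfies this too; it is a cycle of the graph only from
  length 3 on.\<close>

definition cyc :: "'a list \<Rightarrow> bool" where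
  "cyc xs \<longleftrightarrow> path V xs \<and> adj (last xs) (hd xs)"

lemma adj_commute: "adj x y \<longleftrightarrow> adj y x"
  using adj_sym by blast

lemma adj_V': "adj x y \<Longrightarrow> y \<in> V"
  using adj_V adj_sym by blast

lemma finite_nbrs [simp]: "finite (nbrs S x)"
  by (rule finite_subset[OF _ finite_V]) (auto simp: nbrs_def adj_V')

subsection \<open>Independence numbers\<close>

lemma card_le_alpha:
  assumes "finite S" "I \<subseteq> S" "indep I"
  shows "card I \<le> alpha S"
  unfolding alpha_def using assms by (intro Max_ge) auto

lemma alpha_witness:
  assumes "finite S"
  obtains I where "I \<subseteq> S" "indep I" "card I = alpha S"
proof -
  have "alpha S \<in> card ` {I. I \<subseteq> S \<and> indep I}"
    unfolding alpha_def using assms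
    by (intro Max_in) (auto simp: indep_def intro!: exI[of _ "{}"])
  then show thesis using that by auto
qed

lemma alpha_mono:
  assumes "finite T" "S \<subseteq> T"
  shows "alpha S \<le> alpha T"
proof -
  obtain I where "I \<subseteq> S" "indep I" "card I = alpha S"
    using alpha_witness[of S] assms finite_subset by metis
  then show ?thesis using card_le_alpha[of T I] assms by auto
qed

lemma alpha_pos:
  assumes "finite S" "x \<in> S"
  shows "0 < alpha S"
  using card_le_alpha[OF assms(1), of "{x}"] assms adj_irrefl by (auto simp: indep_def)

lemma exists_edge:
  assumes "finite T" "S \<subseteq> T" "alpha T < card S"
  obtains u v where "u \<in> S" "v \<in> S" "adj u v"
  using card_le_alpha[of T S] assms by (auto simp: indep_def)

lemma alpha_union:
  assumes "finite S" "finite T" "S \<inter> T = {}" "\<And>x y. x \<in> S \<Longrightarrow> y \<in> T \<Longrightarrow> \<not> adj x y"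
  shows "alpha S + alpha T \<le> alpha (S \<union> T)"
proof -
  obtain I where I: "I \<subseteq> S" "indep I" "card I = alpha S" using alpha_witness[OF assms(1)] .
  obtain J where J: "J \<subseteq> T" "indep J" "card J = alpha T" using alpha_witness[OF assms(2)] .
  have "indep (I \<union> J)"
    using I J assms(4) adj_sym unfolding indep_def by (metis Un_iff subsetD)
  then have "card (I \<union> J) \<le> alpha (S \<union> T)"
    using I J assms by (intro card_le_alpha) auto
  moreover have "card (I \<union> J) = card I + card J"
    using I J assms by (intro card_Un_disjoint) (auto intro: finite_subset)
  ultimately show ?thesis using I J by simp
qed

subsection \<open>Paths between two colour classes\<close>

lemma joined_sym:
  assumes "joined S A B t"
  shows "joined S B A t"
proof -
  obtain xs where xs: "path S xs" "hd xs \<in> A" "last xs \<in> B" "length xs = Suc t"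
    using assms by (auto simp: joined_def)
  have "successively adj (rev xs)"
    using xs(1) adj_sym unfolding path_def successively_rev
    by (metis (mono_tags, lifting) successively_mono)
  then have "path S (rev xs)" using xs(1) by (auto simp: path_def)
  moreover have "hd (rev xs) \<in> B" "last (rev xs) \<in> A"
    using xs by (auto simp: path_def hd_rev last_rev)
  ultimately show ?thesis using xs(4) unfolding joined_def by (metis length_rev)
qed

lemma path_Cons:
  assumes "path S xs" "x \<in> S" "x \<notin> set xs" "adj x (hd xs)"
  shows "path S (x # xs)"
  using assms by (cases xs) (auto simp: path_def)

text \<open>As long as the forbidden and used vertices number fewer than \<open>m\<close>, the
  current vertex has a free neighbour on the other side. The induction moves the first vertex into
  \<open>F\<close> and swaps \<open>X\<close> with \<open>Y\<close>, which may overlap or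
  coincide.\<close>

lemma greedy_path:
  assumes "\<And>x. x \<in> X \<Longrightarrow> m \<le> card (nbrs Y x)" "\<And>y. y \<in> Y \<Longrightarrow> m \<le> card (nbrs X y)"
    and "finite F" "c \<in> X" "c \<notin> F" "card F + r \<le> m"
  shows "\<exists>xs. path (X \<union> Y) xs \<and> hd xs = c \<and> length xs = Suc r \<and> set xs \<inter> F = {} \<and>
           last xs \<in> (if even r then X else Y)"
  using assms
proof (induction r arbitrary: X Y F c)
  case 0
  then show ?case by (intro exI[of _ "[c]"]) (auto simp: path_def)
next
  case (Suc r)
  have "\<not> nbrs Y c \<subseteq> F"
    using card_mono[OF Suc.prems(3), of "nbrs Y c"] Suc.prems(1)[OF Suc.prems(4)] Suc.prems(6)
    by auto
  then obtain c' where c': "c' \<in> Y" "adj c c'" "c' \<notin> F" by (auto simp: nbrs_def)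
  have "c' \<noteq> c" using c' adj_irrefl by auto
  have "\<exists>xs. path (Y \<union> X) xs \<and> hd xs = c' \<and> length xs = Suc r \<and> set xs \<inter> insert c F = {} \<and>
           last xs \<in> (if even r then Y else X)"
    using Suc.prems c' \<open>c' \<noteq> c\<close> by (intro Suc.IH) auto
  then obtain xs where xs: "path (Y \<union> X) xs" "hd xs = c'" "length xs = Suc r"
    "set xs \<inter> insert c F = {}" "last xs \<in> (if even r then Y else X)" by blast
  have "path (X \<union> Y) (c # xs)"
    using xs c' Suc.prems(4) by (intro path_Cons) (auto simp: Un_commute)
  moreover have "last (c # xs) \<in> (if even (Suc r) then X else Y)"
    using xs by (auto simp: path_def)
  ultimately show ?case using xs Suc.prems(5) by (intro exI[of _ "c # xs"]) auto
qed

text \<open>The path starts at a neighbour of \<open>y\<close>, so \<open>y\<close> can precede it,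
  and before \<open>y\<close> comes whichever of \<open>a\<close>, \<open>b\<close> lies opposite to
  the end of the path. Two vertices are added either way, so the length is the same for both
  outcomes.\<close>

lemma joined_of_fan:
  assumes "a \<in> A" "b \<in> B" "adj y a" "adj y b" "adj y c" "{a, b, y} \<subseteq> S"
    and xs: "path S xs" "hd xs = c" "last xs \<in> A \<union> B" "length xs = Suc r" "set xs \<inter> {a, b, y} = {}"
  shows "joined S A B (r + 2)"
proof -
  have y: "path S (y # xs)" using assms by (intro path_Cons) auto
  have ne: "xs \<noteq> []" using xs by (auto simp: path_def)
  have irr: "a \<noteq> y" "b \<noteq> y" using assms adj_irrefl by auto
  have sym: "adj a y" "adj b y" using assms adj_sym by auto
  show ?thesis
  proof (cases "last xs \<in> A")
    case True
    have "path S (b # y # xs)" using assms irr sym by (intro path_Cons[OF y]) auto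
    then have "joined S B A (r + 2)"
      using True ne assms(2) xs(4) unfolding joined_def by (intro exI[of _ "b # y # xs"]) simp
    then show ?thesis by (rule joined_sym)
  next
    case False
    then have "last xs \<in> B" using xs by auto
    moreover have "path S (a # y # xs)" using assms irr sym by (intro path_Cons[OF y]) auto
    ultimately show ?thesis
      using ne assms(1) xs(4) unfolding joined_def by (intro exI[of _ "a # y # xs"]) simp
  qed
qed

text \<open>Counterpart of \<open>joined_of_fan\<close> that adds three vertices for either outcome,
  which shifts the parity of the length.\<close>

lemma joined_of_triangles:
  assumes "adj a a'" "adj c c'" "a \<in> A" "b \<in> B" "adj y a'" "adj y b" "adj y c" "adj y c'"
    and "{a, a', b, c', y} \<subseteq> S" "a' \<noteq> a" "b \<noteq> c'" "a \<noteq> y"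
    and xs: "path S xs" "hd xs = c" "last xs \<in> A \<union> B" "length xs = Suc r"
      "set xs \<inter> {a, a', b, c', y} = {}"
  shows "joined S A B (r + 3)"
proof -
  have ne: "xs \<noteq> []" using xs by (auto simp: path_def)
  have irr: "a' \<noteq> y" "b \<noteq> y" "c' \<noteq> y" using assms adj_irrefl by auto
  have sym: "adj a' y" "adj b y" "adj c' c" using assms adj_sym by auto
  show ?thesis
  proof (cases "last xs \<in> A")
    case True
    have "path S (c' # xs)" using assms sym by (intro path_Cons) auto
    then have "path S (y # c' # xs)" using assms irr sym by (intro path_Cons) auto
    then have "path S (b # y # c' # xs)" using assms irr sym by (intro path_Cons) auto
    then have "joined S B A (r + 3)"
      using True ne assms(4) xs(4) unfolding joined_def by (intro exI[of _ "b # y # c' # xs"]) simp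
    then show ?thesis by (rule joined_sym)
  next
    case False
    then have "last xs \<in> B" using xs by auto
    moreover have "path S (y # xs)" using assms by (intro path_Cons) auto
    then have "path S (a' # y # xs)" using assms irr sym by (intro path_Cons) auto
    then have "path S (a # a' # y # xs)" using assms irr sym by (intro path_Cons) auto
    ultimately show ?thesis
      using ne assms(3) xs(4) unfolding joined_def by (intro exI[of _ "a # a' # y # xs"]) simp
  qed
qed

lemma two_elements:
  assumes "2 \<le> card M"
  obtains a c where "a \<in> M" "c \<in> M" "a \<noteq> c"
proof -
  have "finite M" using assms card.infinite by fastforce
  then show thesis using that assms card_le_Suc0_iff_eq[of M] by auto
qed

text \<open>Write \<open>c\<close> for the start of a greedy path and \<open>w\<close> for its end. If \<open>w \<in> A\<close>, prepend \<open>b, y\<close>; if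
  \<open>w \<in> B\<close>, prepend \<open>a, y\<close>. The resulting length has a fixed parity, and the other parity comes from
  \<open>b, y, c'\<close> and \<open>a, a', y\<close>, where \<open>aa'\<close> and \<open>cc'\<close> are disjoint edges inside the neighbourhood
  of \<open>y\<close>.\<close>

lemma joined_bipartite_aux:
  assumes degX: "\<And>x. x \<in> A \<union> B \<Longrightarrow> m \<le> card (nbrs Y x)"
    and degY: "\<And>y. y \<in> Y \<Longrightarrow> m \<le> card (nbrs (A \<union> B) y)"
    and AB: "A \<inter> B = {}" "A \<subseteq> V" and y: "y \<in> Y" "b \<in> nbrs B y"
    and big: "alpha V + 3 \<le> card (nbrs A y)" and t: "2 \<le> t" "t + 3 \<le> m"
  shows "joined (A \<union> B \<union> Y) A B t"
proof -
  let ?M = "nbrs A y"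
  have b: "b \<in> B" "adj y b" using y by (auto simp: nbrs_def)
  have subV: "\<And>S. ?M - S \<subseteq> V" using AB by (auto simp: nbrs_def)
  show ?thesis
  proof (cases "even t")
    case True
    obtain a c where ac: "a \<in> ?M" "c \<in> ?M" "a \<noteq> c" using big two_elements[of ?M] by auto
    \<comment> \<open>Here \<open>r\<close> is even, so a path that alternates from \<open>c\<close>
      ends in \<open>A \<union> B\<close> again.\<close>
    define r where "r = t - 2"
    have "card {a, b, y} \<le> 3" by (simp add: card_insert_if)
    then have "\<exists>xs. path (A \<union> B \<union> Y) xs \<and> hd xs = c \<and> length xs = Suc r \<and>
        set xs \<inter> {a, b, y} = {} \<and> last xs \<in> (if even r then A \<union> B else Y)"
      using degX degY ac b AB t adj_irrefl
      by (intro greedy_path[where m = m]) (auto simp: nbrs_def r_def)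
    then obtain xs where "path (A \<union> B \<union> Y) xs" "hd xs = c" "length xs = Suc r"
        "set xs \<inter> {a, b, y} = {}" "last xs \<in> A \<union> B"
      using True t by (auto simp: r_def)
    then have "joined (A \<union> B \<union> Y) A B (r + 2)"
      using ac b y by (intro joined_of_fan[of a A b B y c]) (auto simp: nbrs_def)
    moreover have "r + 2 = t" using t by (simp add: r_def)
    ultimately show ?thesis by metis
  next
    case False
    obtain a a' where aa: "a \<in> ?M" "a' \<in> ?M" "adj a a'"
      using exists_edge[OF finite_V, of ?M] big subV[of "{}"] by auto
    \<comment> \<open>Without \<open>a\<close> and \<open>a'\<close> at least
      \<open>alpha V + 1\<close> neighbours remain, enough for a second edge disjoint from the
      first.\<close>
    have "card ?M - card {a, a'} \<le> card (?M - {a, a'})" by (rule diff_card_le_card_Diff) simp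
    then have "alpha V < card (?M - {a, a'})" using big by (simp add: card_insert_if split: if_splits)
    then obtain c c' where cc: "c \<in> ?M - {a, a'}" "c' \<in> ?M - {a, a'}" "adj c c'"
      using exists_edge[OF finite_V subV] by metis
    define r where "r = t - 3"
    have t3: "3 \<le> t" using False t by (cases "t = 2") auto
    have "card {a, a', b, c', y} \<le> 5" by (simp add: card_insert_if)
    moreover have "c \<noteq> c'" "c \<noteq> y" using cc adj_irrefl by (auto simp: nbrs_def)
    ultimately have "\<exists>xs. path (A \<union> B \<union> Y) xs \<and> hd xs = c \<and> length xs = Suc r \<and>
        set xs \<inter> {a, a', b, c', y} = {} \<and> last xs \<in> (if even r then A \<union> B else Y)"
      using degX degY cc b AB t t3
      by (intro greedy_path[where m = m]) (auto simp: nbrs_def r_def)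
    then obtain xs where xs: "path (A \<union> B \<union> Y) xs" "hd xs = c" "length xs = Suc r"
        "set xs \<inter> {a, a', b, c', y} = {}" "last xs \<in> A \<union> B"
      using False t3 by (auto simp: r_def)
    have "a' \<noteq> a" "a \<noteq> y" "b \<noteq> c'" using aa cc b AB adj_irrefl by (auto simp: nbrs_def)
    then have "joined (A \<union> B \<union> Y) A B (r + 3)"
      using aa cc b y xs by (intro joined_of_triangles[of a a' c c' A b B y]) (auto simp: nbrs_def)
    moreover have "r + 3 = t" using t3 by (simp add: r_def)
    ultimately show ?thesis by metis
  qed
qed

text \<open>Since \<open>y\<close> has at least \<open>2 * alpha V + 5\<close> neighbours, one class
  contains \<open>alpha V + 3\<close> of them; the symmetry of \<open>joined\<close> lets that class
  play the role of \<open>A\<close>.\<close>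

lemma joined_bipartite:
  assumes degX: "\<And>x. x \<in> A \<union> B \<Longrightarrow> m \<le> card (nbrs Y x)"
    and degY: "\<And>y. y \<in> Y \<Longrightarrow> m \<le> card (nbrs (A \<union> B) y)"
    and AB: "A \<inter> B = {}" "A \<union> B \<subseteq> V" and y: "y \<in> Y" "nbrs A y \<noteq> {}" "nbrs B y \<noteq> {}"
    and m: "2 * alpha V + 5 \<le> m" and t: "2 \<le> t" "t + 3 \<le> m"
  shows "joined (A \<union> B \<union> Y) A B t"
proof -
  have "nbrs (A \<union> B) y = nbrs A y \<union> nbrs B y" by (auto simp: nbrs_def)
  then have "m \<le> card (nbrs A y) + card (nbrs B y)"
    using degY[OF y(1)] card_Un_le order_trans by metis
  then consider "alpha V + 3 \<le> card (nbrs A y)" | "alpha V + 3 \<le> card (nbrs B y)"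
    using m by linarith
  then show ?thesis
  proof cases
    case 1
    then show ?thesis using assms by (auto intro!: joined_bipartite_aux[where m = m])
  next
    case 2
    obtain a where "a \<in> nbrs A y" using y(2) by blast
    then have "joined (B \<union> A \<union> Y) B A t"
      using 2 assms by (intro joined_bipartite_aux[where m = m and y = y and b = a])
        (auto simp: Un_commute)
    then show ?thesis by (metis joined_sym Un_commute)
  qed
qed

text \<open>The greedy path never leaves \<open>A \<union> B\<close>, so its end lies in one of the
  classes whatever its parity, and the fan alone suffices.\<close>

lemma joined_within:
  assumes deg: "\<And>x. x \<in> A \<union> B \<Longrightarrow> m \<le> card (nbrs (A \<union> B) x)"
    and AB: "A \<inter> B = {}" and y: "y \<in> A \<union> B" "nbrs A y \<noteq> {}" "nbrs B y \<noteq> {}"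
    and m: "3 \<le> m" and t: "2 \<le> t" "t + 1 \<le> m"
  shows "joined (A \<union> B) A B t"
proof -
  have main: "joined (A \<union> B) A B t"
    if deg: "\<And>x. x \<in> A \<union> B \<Longrightarrow> m \<le> card (nbrs (A \<union> B) x)"
      and AB: "A \<inter> B = {}" and y: "y \<in> A \<union> B" "nbrs B y \<noteq> {}" and 2: "2 \<le> card (nbrs A y)"
    for A B
  proof -
    obtain b where b: "b \<in> nbrs B y" using y by auto
    obtain a c where ac: "a \<in> nbrs A y" "c \<in> nbrs A y" "a \<noteq> c" using two_elements[OF 2] .
    define r where "r = t - 2"
    have "card {a, b, y} \<le> 3" by (simp add: card_insert_if)
    moreover have "c \<noteq> y" using ac adj_irrefl by (auto simp: nbrs_def)
    ultimately have "\<exists>xs. path (A \<union> B \<union> (A \<union> B)) xs \<and> hd xs = c \<and> length xs = Suc r \<and>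
        set xs \<inter> {a, b, y} = {} \<and> last xs \<in> (if even r then A \<union> B else A \<union> B)"
      using ac b AB t by (intro greedy_path[where m = m] deg) (auto simp: nbrs_def r_def)
    then obtain xs where "path (A \<union> B) xs" "hd xs = c" "length xs = Suc r"
        "set xs \<inter> {a, b, y} = {}" "last xs \<in> A \<union> B" by auto
    then have "joined (A \<union> B) A B (r + 2)"
      using ac b y by (intro joined_of_fan[of a A b B y c]) (auto simp: nbrs_def)
    moreover have "r + 2 = t" using t by (simp add: r_def)
    ultimately show ?thesis by metis
  qed
  have "nbrs (A \<union> B) y = nbrs A y \<union> nbrs B y" by (auto simp: nbrs_def)
  then have "m \<le> card (nbrs A y) + card (nbrs B y)"
    using deg[OF y(1)] card_Un_le order_trans by metis
  then consider "2 \<le> card (nbrs A y)" | "2 \<le> card (nbrs B y)" using m by linarith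
  then show ?thesis
  proof cases
    case 1
    then show ?thesis using deg AB y by (intro main) auto
  next
    case 2
    have "joined (B \<union> A) B A t" using 2 deg AB y by (intro main) (auto simp: Un_commute)
    then show ?thesis by (metis joined_sym Un_commute)
  qed
qed

subsection \<open>Dense subgraphs\<close>

text \<open>The sets may overlap: edges inside a single level are treated as a pair as well.\<close>

definition bideg :: "nat \<Rightarrow> 'a set \<Rightarrow> 'a set \<Rightarrow> bool" where
  "bideg m X Y \<longleftrightarrow> (\<forall>x\<in>X. m \<le> card (nbrs Y x)) \<and> (\<forall>y\<in>Y. m \<le> card (nbrs X y))"

lemma sum_nbrs_swap:
  assumes "finite X" "finite Y"
  shows "(\<Sum>x\<in>X. card (nbrs Y x)) = (\<Sum>y\<in>Y. card (nbrs X y))"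
proof -
  have "{x \<in> X. adj x y} = nbrs X y" for y by (auto simp: nbrs_def adj_commute)
  then have "(\<Sum>x\<in>X. card {y \<in> Y. adj x y}) = (\<Sum>y\<in>Y. card (nbrs X y))"
    using assms by (intro sum_multicount_gen) simp_all
  then show ?thesis by (simp add: nbrs_def)
qed

text \<open>Vertices of degree below \<open>m\<close> are deleted one by one. Each deletion lowers
  the left side of the inequality by \<open>m\<close> and the edge count by less, so the inequality
  survives and keeps \<open>X\<close> nonempty.\<close>

lemma dense_subpair:
  assumes "finite X" "finite Y" "m * (card X + card Y) < (\<Sum>x\<in>X. card (nbrs Y x))"
  shows "\<exists>X' Y'. X' \<subseteq> X \<and> Y' \<subseteq> Y \<and> X' \<noteq> {} \<and> bideg m X' Y'"
proof -
  have remove: "m * (card (X - {x}) + card Y) < (\<Sum>x\<in>X - {x}. card (nbrs Y x))"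
    if "finite X" "finite Y" "m * (card X + card Y) < (\<Sum>x\<in>X. card (nbrs Y x))"
      "x \<in> X" "card (nbrs Y x) < m" for X Y x
  proof -
    have "Suc (card (X - {x})) = card X" using that by (metis card_Suc_Diff1)
    then have "m * (card X + card Y) = m + m * (card (X - {x}) + card Y)" by (metis add_Suc mult_Suc_right)
    moreover have "(\<Sum>x\<in>X. card (nbrs Y x)) = card (nbrs Y x) + (\<Sum>x\<in>X - {x}. card (nbrs Y x))"
      using that by (simp add: sum.remove)
    ultimately show ?thesis using that by linarith
  qed
  show ?thesis
    using assms
  proof (induction "card X + card Y" arbitrary: X Y rule: less_induct)
    case less
    show ?case
    proof (cases "bideg m X Y")
      case True
      moreover have "X \<noteq> {}" using less.prems by auto
      ultimately show ?thesis by blast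
    next
      case False
      then consider x where "x \<in> X" "card (nbrs Y x) < m" | y where "y \<in> Y" "card (nbrs X y) < m"
        by (auto simp: bideg_def not_le)
      then show ?thesis
      proof cases
        case 1
        have "\<exists>X' Y'. X' \<subseteq> X - {x} \<and> Y' \<subseteq> Y \<and> X' \<noteq> {} \<and> bideg m X' Y'"
          using 1 less.prems card_Diff1_less[of X x] by (intro less.hyps remove) auto
        then show ?thesis by blast
      next
        case 2
        \<comment> \<open>Double counting the edges reduces this to \<open>remove\<close> with the
          two sides exchanged.\<close>
        have "m * (card (Y - {y}) + card X) < (\<Sum>x\<in>Y - {y}. card (nbrs X x))"
          using 2 less.prems by (intro remove) (auto simp: sum_nbrs_swap add.commute)
        then have "m * (card X + card (Y - {y})) < (\<Sum>x\<in>X. card (nbrs (Y - {y}) x))"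
          using less.prems by (simp add: sum_nbrs_swap add.commute)
        then have "\<exists>X' Y'. X' \<subseteq> X \<and> Y' \<subseteq> Y - {y} \<and> X' \<noteq> {} \<and> bideg m X' Y'"
          using 2 less.prems card_Diff1_less[of Y y] by (intro less.hyps) auto
        then show ?thesis by blast
      qed
    qed
  qed
qed

text \<open>\<open>X'\<close> is chosen of least size. If no vertex of \<open>Y'\<close> saw both
  classes, then \<open>A\<close> with the vertices that see it would be a smaller pair of the same
  degree.\<close>

lemma connected_subpair:
  assumes "finite X" "Y \<subseteq> W" "X \<noteq> {}" "bideg m X Y"
  obtains X' Y' where "X' \<subseteq> X" "Y' \<subseteq> W" "X' \<noteq> {}" "bideg m X' Y'"
    "\<And>A B. A \<union> B = X' \<Longrightarrow> A \<inter> B = {} \<Longrightarrow> A \<noteq> {} \<Longrightarrow> B \<noteq> {} \<Longrightarrow>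
      \<exists>y\<in>Y'. nbrs A y \<noteq> {} \<and> nbrs B y \<noteq> {}"
proof -
  let ?P = "\<lambda>Z. Z \<subseteq> X \<and> Z \<noteq> {} \<and> (\<exists>Y'\<subseteq>W. bideg m Z Y')"
  have "?P X" using assms by auto
  then obtain X' where X': "?P X'" and min: "\<And>Z. ?P Z \<Longrightarrow> card X' \<le> card Z"
    by (rule ex_has_least_nat[of ?P X card, THEN exE]) blast
  then obtain Y' where Y': "Y' \<subseteq> W" "bideg m X' Y'" by auto
  show thesis
  proof (rule that[of X' Y'])
    fix A B assume AB: "A \<union> B = X'" "A \<inter> B = {}" "A \<noteq> {}" "B \<noteq> {}"
    show "\<exists>y\<in>Y'. nbrs A y \<noteq> {} \<and> nbrs B y \<noteq> {}"
    proof (rule ccontr)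
      assume no: "\<not> ?thesis"
      let ?Y = "{y \<in> Y'. nbrs A y \<noteq> {}}"
      have nY: "nbrs ?Y x = nbrs Y' x" if "x \<in> A" for x
        using that by (auto simp: nbrs_def adj_commute)
      have nA: "nbrs A y = nbrs X' y" if "y \<in> ?Y" for y
      proof -
        have "nbrs B y = {}" using no that by auto
        then show ?thesis using AB by (auto simp: nbrs_def)
      qed
      have "bideg m A ?Y"
        unfolding bideg_def
      proof (intro conjI ballI)
        fix x assume "x \<in> A"
        then show "m \<le> card (nbrs ?Y x)" using nY Y'(2) AB(1) unfolding bideg_def by (metis UnI1)
      next
        fix y assume "y \<in> ?Y"
        then show "m \<le> card (nbrs A y)" using nA[of y] Y'(2) unfolding bideg_def by simp
      qed
      then have "?P A" using AB X' Y' by (auto intro!: exI[of _ ?Y])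
      moreover have "card A < card X'"
        using AB X' assms(1) by (intro psubset_card_mono) (auto intro: finite_subset)
      ultimately show False using min[of A] by simp
    qed
  qed (use X' Y' in auto)
qed

text \<open>\<open>H\<close> is a smallest subset with \<open>m * alpha H < card H\<close>. Deleting
  \<open>x\<close> and its neighbours lowers \<open>alpha\<close> by at least one, so by minimality
  it removes more than \<open>m\<close> vertices. The last property rules out that \<open>H\<close>
  is disconnected or bipartite.\<close>

lemma connected_subset:
  assumes "finite S" "m * alpha S < card S" "2 \<le> m"
  obtains H where "H \<subseteq> S" "\<And>x. x \<in> H \<Longrightarrow> m \<le> card (nbrs H x)" "H \<noteq> {}"
    "\<And>A B. A \<union> B = H \<Longrightarrow> A \<inter> B = {} \<Longrightarrow> A \<noteq> {} \<Longrightarrow> B \<noteq> {} \<Longrightarrow>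
      \<exists>y\<in>H. nbrs A y \<noteq> {} \<and> nbrs B y \<noteq> {}"
proof -
  let ?P = "\<lambda>H. H \<subseteq> S \<and> m * alpha H < card H"
  have "?P S" using assms by auto
  then obtain H where H: "?P H" and min: "\<And>Z. ?P Z \<Longrightarrow> card H \<le> card Z"
    by (rule ex_has_least_nat[of ?P S card, THEN exE]) blast
  have finH: "finite H" using H assms(1) finite_subset by auto
  have small: "card Z \<le> m * alpha Z" if "Z \<subset> H" for Z
    using min[of Z] psubset_card_mono[OF finH that] that H by (meson not_le order_trans psubset_imp_subset)
  show thesis
  proof (rule that[of H])
    fix x assume x: "x \<in> H"
    let ?Z = "H - insert x (nbrs H x)"
    have "alpha {x} + alpha ?Z \<le> alpha ({x} \<union> ?Z)"
      using finH by (intro alpha_union) (auto simp: nbrs_def)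
    also have "\<dots> \<le> alpha H" using x finH by (intro alpha_mono) auto
    finally have "Suc (alpha ?Z) \<le> alpha H" using alpha_pos[of "{x}" x] by simp
    then have "m * Suc (alpha ?Z) \<le> m * alpha H" by (rule mult_le_mono2)
    moreover have "card ?Z \<le> m * alpha ?Z" using x by (intro small) auto
    moreover have "card H = card ?Z + card (insert x (nbrs H x))"
    proof -
      have "insert x (nbrs H x) \<subseteq> H" using x by (auto simp: nbrs_def)
      then show ?thesis using card_Diff_subset[of "insert x (nbrs H x)" H] card_mono[OF finH] by simp
    qed
    moreover have "card (insert x (nbrs H x)) = Suc (card (nbrs H x))"
      using adj_irrefl by (intro card_insert_disjoint finite_nbrs) (auto simp: nbrs_def)
    ultimately show "m \<le> card (nbrs H x)" using H unfolding mult_Suc_right by linarith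
  next
    show "H \<noteq> {}" using H by auto
  next
    fix A B assume AB: "A \<union> B = H" "A \<inter> B = {}" "A \<noteq> {}" "B \<noteq> {}"
    show "\<exists>y\<in>H. nbrs A y \<noteq> {} \<and> nbrs B y \<noteq> {}"
    proof (rule ccontr)
      assume no: "\<not> ?thesis"
      \<comment> \<open>Every vertex has neighbours in one class only, so no edge leaves \<open>P\<close>, \<open>Q\<close> or \<open>R1 \<union> R2\<close>, and
        \<open>R1 \<union> R2\<close> is bipartite. So one of \<open>P\<close> and \<open>Q\<close> has ratio above \<open>m\<close>, against minimality.\<close>
      define P where "P = {x \<in> A. nbrs B x = {}}"
      define Q where "Q = {x \<in> B. nbrs A x = {}}"
      define R1 where "R1 = {x \<in> A. nbrs A x = {} \<and> nbrs B x \<noteq> {}}"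
      define R2 where "R2 = {x \<in> B. nbrs B x = {} \<and> nbrs A x \<noteq> {}}"
      have fin: "finite P" "finite Q" "finite R1" "finite R2"
        using finH AB unfolding P_def Q_def R1_def R2_def by (auto intro: finite_subset)
      have H_eq: "H = P \<union> (Q \<union> (R1 \<union> R2))" using no AB by (auto simp: P_def Q_def R1_def R2_def)
      have disj: "P \<inter> (Q \<union> (R1 \<union> R2)) = {}" "Q \<inter> (R1 \<union> R2) = {}" "R1 \<inter> R2 = {}"
        using AB by (auto simp: P_def Q_def R1_def R2_def)
      have noedge: "\<not> adj x y" if "x \<in> P" "y \<in> Q \<union> (R1 \<union> R2)" for x y
        using that adj_sym[of x y] by (auto simp: P_def Q_def R1_def R2_def nbrs_def)
      have noedge': "\<not> adj x y" if "x \<in> Q" "y \<in> R1 \<union> R2" for x y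
        using that adj_sym[of x y] by (auto simp: Q_def R1_def R2_def nbrs_def)
      have "alpha P + alpha (Q \<union> (R1 \<union> R2)) \<le> alpha H"
        unfolding H_eq using fin disj noedge by (intro alpha_union) auto
      moreover have "alpha Q + alpha (R1 \<union> R2) \<le> alpha (Q \<union> (R1 \<union> R2))"
        using fin disj noedge' by (intro alpha_union) auto
      ultimately have "m * (alpha P + alpha Q + alpha (R1 \<union> R2)) \<le> m * alpha H"
        by (intro mult_le_mono2) simp
      moreover have "card P \<le> m * alpha P" by (rule small) (use AB in \<open>auto simp: P_def\<close>)
      moreover have "card Q \<le> m * alpha Q" by (rule small) (use AB in \<open>auto simp: Q_def\<close>)
      moreover have "card (R1 \<union> R2) \<le> m * alpha (R1 \<union> R2)"
      proof -
        have "indep R1" "indep R2" by (auto simp: indep_def R1_def R2_def nbrs_def)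
        then have "card R1 \<le> alpha (R1 \<union> R2)" "card R2 \<le> alpha (R1 \<union> R2)"
          using fin by (auto intro!: card_le_alpha)
        then have "card (R1 \<union> R2) \<le> 2 * alpha (R1 \<union> R2)"
          using card_Un_le[of R1 R2] by linarith
        also have "\<dots> \<le> m * alpha (R1 \<union> R2)" using assms(3) by (rule mult_le_mono1)
        finally show ?thesis .
      qed
      moreover have "card H = card P + (card Q + card (R1 \<union> R2))"
        unfolding H_eq using fin disj by (simp add: card_Un_disjoint)
      ultimately show False using H by (simp add: add_mult_distrib2)
    qed
  qed (use H in auto)
qed

subsection \<open>Breadth-first search\<close>

primrec ball :: "'a \<Rightarrow> nat \<Rightarrow> 'a set" where
  "ball v 0 = {v}"
| "ball v (Suc i) = ball v i \<union> {y. \<exists>x\<in>ball v i. adj x y}"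

definition level :: "'a \<Rightarrow> nat \<Rightarrow> 'a set" where
  "level v i = {x \<in> ball v i. \<forall>j<i. x \<notin> ball v j}"

lemma ball_subset: "v \<in> V \<Longrightarrow> ball v i \<subseteq> V"
  by (induction i) (auto simp: adj_V')

lemma level_subset: "v \<in> V \<Longrightarrow> level v i \<subseteq> V"
  using ball_subset by (auto simp: level_def)

lemma finite_level: "v \<in> V \<Longrightarrow> finite (level v i)"
  using level_subset finite_V finite_subset by blast

lemma level_disjoint: "i \<noteq> j \<Longrightarrow> level v i \<inter> level v j = {}"
  by (cases i j rule: linorder_cases) (auto simp: level_def)

lemma level_0: "level v 0 = {v}"
  by (auto simp: level_def)

lemma level_1: "level v (Suc 0) = nbrs V v"
  using adj_irrefl adj_V' by (auto simp: level_def nbrs_def)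

lemma level_parent:
  assumes "x \<in> level v (Suc i)"
  shows "\<exists>y\<in>level v i. adj y x"
proof -
  have "x \<notin> ball v i" using assms by (auto simp: level_def)
  then obtain y where y: "y \<in> ball v i" "adj y x" using assms by (auto simp: level_def)
  moreover have "y \<notin> ball v j" if "j < i" for j
  proof
    assume "y \<in> ball v j"
    then have "x \<in> ball v (Suc j)" using y by auto
    then show False using assms that by (auto simp: level_def)
  qed
  ultimately show ?thesis by (auto simp: level_def)
qed

lemma level_nbr:
  assumes "x \<in> level v i" "adj x y"
  obtains j where "y \<in> level v j" "j \<le> Suc i" "i \<le> Suc j"
proof -
  have y: "y \<in> ball v (Suc i)" using assms by (auto simp: level_def)
  define j where "j = (LEAST j. y \<in> ball v j)"
  have j: "y \<in> ball v j" unfolding j_def using y by (rule LeastI)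
  have "y \<in> level v j" using j not_less_Least unfolding level_def j_def by auto
  moreover have "j \<le> Suc i" unfolding j_def using y by (rule Least_le)
  moreover have "x \<in> ball v (Suc j)" using j assms(2) adj_sym by auto
  then have "i \<le> Suc j" using assms(1) by (auto simp: level_def not_less[symmetric])
  ultimately show thesis using that by blast
qed

lemma nbrs_level:
  assumes "x \<in> level v (Suc i)"
  shows "nbrs V x = nbrs (level v i) x \<union> nbrs (level v (Suc i)) x \<union> nbrs (level v (Suc (Suc i))) x"
proof (intro equalityI subsetI)
  fix y assume "y \<in> nbrs V x"
  then have xy: "adj x y" by (simp add: nbrs_def)
  obtain j where j: "y \<in> level v j" "j \<le> Suc (Suc i)" "Suc i \<le> Suc j"
    using level_nbr[OF assms xy] .
  then have "j = i \<or> j = Suc i \<or> j = Suc (Suc i)" by auto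
  then show "y \<in> nbrs (level v i) x \<union> nbrs (level v (Suc i)) x \<union> nbrs (level v (Suc (Suc i))) x"
    using j xy by (auto simp: nbrs_def)
qed (auto simp: nbrs_def adj_V')

text \<open>Climbing from both ends of the path up to the first common ancestor closes the cycle.\<close>

lemma cyc_of_path:
  assumes par: "\<And>i x. x \<in> level v (Suc i) \<Longrightarrow> par x \<in> level v i \<and> adj (par x) x" and v: "v \<in> V"
    and "path (\<Union>i\<in>{j..}. level v i) xs" "hd xs \<in> level v j" "last xs \<in> level v j"
    and "1 \<le> h" "h \<le> j" "(par ^^ h) (hd xs) = (par ^^ h) (last xs)"
    and "\<And>q. q < h \<Longrightarrow> (par ^^ q) (hd xs) \<noteq> (par ^^ q) (last xs)"
  shows "\<exists>ys. cyc ys \<and> length ys + 1 = length xs + 2 * h"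
  using assms(3-)
proof (induction h arbitrary: j xs)
  case 0
  then show ?case by simp
next
  case (Suc h)
  obtain j' where j: "j = Suc j'" using Suc.prems by (cases j) auto
  let ?U = "\<lambda>j. \<Union>i\<in>{j..}. level v i"
  let ?a = "par (hd xs)" and ?b = "par (last xs)"
  have ne: "xs \<noteq> []" using Suc.prems by (auto simp: path_def)
  have a: "?a \<in> level v j'" "adj ?a (hd xs)" and b: "?b \<in> level v j'" "adj ?b (last xs)"
    using par Suc.prems j by auto
  have UV: "?U j' \<subseteq> V" using level_subset[OF v] by auto
  have UU: "?U j \<subseteq> ?U j'" unfolding j by (intro UN_mono) auto
  \<comment> \<open>The path stays in levels \<open>j\<close> and beyond, so the parents of its
    ends, in level \<open>j'\<close>, are new vertices.\<close>
  have notU: "x \<notin> ?U j" if "x \<in> level v j'" for x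
  proof
    assume "x \<in> ?U j"
    then obtain i where "i \<ge> j" "x \<in> level v i" by auto
    then show False using level_disjoint[of i j' v] that j by auto
  qed
  have xs: "path (?U j') xs" using Suc.prems UU by (auto simp: path_def)
  have "?a \<notin> set xs" "?b \<notin> set xs" using notU a b Suc.prems(1) unfolding path_def by blast+
  have a_xs: "path (?U j') (?a # xs)"
    using xs a \<open>?a \<notin> set xs\<close> by (intro path_Cons) auto
  \<comment> \<open>If the parents coincide, this one vertex closes the cycle; otherwise both are
    attached and the climb goes on. In all \<open>2 * h - 1\<close> vertices are added.\<close>
  show ?case
  proof (cases "h = 0")
    case True
    then have "?a = ?b" using Suc.prems by simp
    then have "cyc (?a # xs)"
      using a_xs adj_sym[OF b(2)] ne UV unfolding cyc_def path_def by auto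
    then show ?thesis using True by (intro exI[of _ "?a # xs"]) simp
  next
    case False
    have ab: "?a \<noteq> ?b" using Suc.prems(7)[of 1] False by simp
    let ?ys = "?a # xs @ [?b]"
    have "path (?U j') ?ys"
      using a_xs b ab \<open>?b \<notin> set xs\<close> adj_sym[OF b(2)] ne
      unfolding path_def append_Cons[symmetric] successively_append_iff by auto
    moreover have "(par ^^ q) (par x) = (par ^^ Suc q) x" for q x
      by (simp add: funpow_swap1)
    then have "(par ^^ h) ?a = (par ^^ h) ?b" "\<And>q. q < h \<Longrightarrow> (par ^^ q) ?a \<noteq> (par ^^ q) ?b"
      using Suc.prems(6) Suc.prems(7)[of "Suc _"] by simp_all
    ultimately have "\<exists>zs. cyc zs \<and> length zs + 1 = length ?ys + 2 * h"
      using a(1) b(1) False Suc.prems(5) j by (intro Suc.IH[of j' ?ys]) simp_all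
    then show ?thesis by auto
  qed
qed

text \<open>Fix a search tree \<open>par\<close> and let \<open>h\<close> be the least height at
  which all of \<open>X\<close> has a common ancestor. One height lower the ancestors differ:
  \<open>A\<close> collects the vertices below one of them and \<open>B\<close> the rest.\<close>

lemma level_split:
  assumes "v \<in> V" "X \<subseteq> level v j" "2 \<le> card X"
  obtains h A B where "1 \<le> h" "h \<le> j" "A \<union> B = X" "A \<inter> B = {}" "A \<noteq> {}" "B \<noteq> {}"
    "\<And>t. joined (level v j \<union> level v (Suc j)) A B t \<Longrightarrow> \<exists>ys. cyc ys \<and> length ys = t + 2 * h"
proof -
  have "\<exists>par. \<forall>i. \<forall>x\<in>level v (Suc i). par x \<in> level v i \<and> adj (par x) x"
  proof -
    \<comment> \<open>The parent can be chosen independently of \<open>i\<close> because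
      \<open>x\<close> lies in at most one level.\<close>
    have "\<exists>y. \<forall>i. x \<in> level v (Suc i) \<longrightarrow> y \<in> level v i \<and> adj y x" for x
    proof (cases "\<exists>i. x \<in> level v (Suc i)")
      case True
      then obtain i where i: "x \<in> level v (Suc i)" by blast
      then obtain y where "y \<in> level v i" "adj y x" using level_parent by blast
      moreover have "i' = i" if "x \<in> level v (Suc i')" for i'
        using level_disjoint[of "Suc i" "Suc i'" v] i that by auto
      ultimately show ?thesis by blast
    qed auto
    then show ?thesis by metis
  qed
  then obtain par where par: "\<And>i x. x \<in> level v (Suc i) \<Longrightarrow> par x \<in> level v i \<and> adj (par x) x"
    by blast
  have top: "(par ^^ q) x \<in> level v (j - q)" if "x \<in> level v j" "q \<le> j" for x q
    using that
  proof (induction q)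
    case (Suc q)
    then have "(par ^^ q) x \<in> level v (Suc (j - Suc q))" by (simp add: Suc_diff_Suc)
    then show ?case using par by simp
  qed simp
  let ?P = "\<lambda>h. \<forall>x\<in>X. \<forall>y\<in>X. (par ^^ h) x = (par ^^ h) y"
  have Pj: "?P j"
  proof (intro ballI)
    fix x y assume "x \<in> X" "y \<in> X"
    then have "x \<in> level v j" "y \<in> level v j" using assms(2) by auto
    then show "(par ^^ j) x = (par ^^ j) y" using top[of x j] top[of y j] by (simp add: level_0)
  qed
  define h where "h = (LEAST h. ?P h)"
  have Ph: "?P h" unfolding h_def using Pj by (rule LeastI)
  have hj: "h \<le> j" unfolding h_def using Pj by (rule Least_le)
  have h: "1 \<le> h"
  proof (rule ccontr)
    assume "\<not> 1 \<le> h"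
    then have "\<forall>x\<in>X. \<forall>y\<in>X. x = y" using Ph by (auto simp: not_le)
    moreover obtain a c where "a \<in> X" "c \<in> X" "a \<noteq> c" using two_elements[OF assms(3)] .
    ultimately show False by blast
  qed
  then have "\<not> ?P (h - 1)" using not_less_Least[of "h - 1" ?P] unfolding h_def by fastforce
  then obtain x y where xy: "x \<in> X" "y \<in> X" "(par ^^ (h - 1)) x \<noteq> (par ^^ (h - 1)) y" by blast
  define A where "A = {z \<in> X. (par ^^ (h - 1)) z = (par ^^ (h - 1)) x}"
  show thesis
  proof (rule that[of h A "X - A"])
    fix t assume "joined (level v j \<union> level v (Suc j)) A (X - A) t"
    then obtain xs where xs: "path (level v j \<union> level v (Suc j)) xs" "hd xs \<in> A" "last xs \<in> X - A"
      "length xs = Suc t" by (auto simp: joined_def)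
    have "level v j \<union> level v (Suc j) \<subseteq> (\<Union>i\<in>{j..}. level v i)"
      using UN_upper[of j "{j..}" "level v"] UN_upper[of "Suc j" "{j..}" "level v"] by simp
    then have p: "path (\<Union>i\<in>{j..}. level v i) xs" using xs(1) by (auto simp: path_def)
    have ends: "hd xs \<in> X" "last xs \<in> X" using xs by (auto simp: A_def)
    \<comment> \<open>Ancestors that agree at height \<open>q\<close> would still agree at height
      \<open>h - 1\<close>, where the classes are separated.\<close>
    have "(par ^^ q) (hd xs) \<noteq> (par ^^ q) (last xs)" if "q < h" for q
    proof
      assume "(par ^^ q) (hd xs) = (par ^^ q) (last xs)"
      then have "(par ^^ (h - 1 - q)) ((par ^^ q) (hd xs)) = (par ^^ (h - 1 - q)) ((par ^^ q) (last xs))"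
        by simp
      then have "(par ^^ (h - 1)) (hd xs) = (par ^^ (h - 1)) (last xs)"
        using that funpow_add[of "h - 1 - q" q par] by simp
      then show False using xs ends by (auto simp: A_def)
    qed
    moreover have "hd xs \<in> level v j" "last xs \<in> level v j" "(par ^^ h) (hd xs) = (par ^^ h) (last xs)"
      using ends assms(2) Ph by blast+
    ultimately have "\<exists>ys. cyc ys \<and> length ys + 1 = length xs + 2 * h"
      using cyc_of_path[of v par j xs h] par assms(1) p h hj by blast
    then show "\<exists>ys. cyc ys \<and> length ys = t + 2 * h" using xs(4) by auto
  qed (use h hj xy in \<open>auto simp: A_def\<close>)
qed

lemma joined_mono: "joined S A B t \<Longrightarrow> S \<subseteq> T \<Longrightarrow> joined T A B t"
  unfolding joined_def path_def by blast

subsection \<open>Cycles of prescribed length\<close>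

text \<open>As \<open>h \<le> i\<close>, the last hypothesis leaves \<open>l - 2 * h \<ge> 2\<close>
  edges for the path inside \<open>H\<close>.\<close>

lemma cycle_in_large_level:
  assumes "v \<in> V" "(l + 5) * alpha V < card (level v i)" "2 * i + 2 \<le> l"
  shows "\<exists>xs. cyc xs \<and> length xs = l"
proof -
  let ?m = "l + 5" and ?L = "level v i \<union> level v (Suc i)"
  have "?m * alpha (level v i) \<le> ?m * alpha V"
    using alpha_mono[OF finite_V level_subset[OF assms(1)]] by (rule mult_le_mono2)
  then have big: "?m * alpha (level v i) < card (level v i)" using assms(2) by (rule le_less_trans)
  have two: "2 \<le> ?m" by simp
  obtain H where H: "H \<subseteq> level v i" "\<And>x. x \<in> H \<Longrightarrow> ?m \<le> card (nbrs H x)" "H \<noteq> {}"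
    and conn: "\<And>A B. A \<union> B = H \<Longrightarrow> A \<inter> B = {} \<Longrightarrow> A \<noteq> {} \<Longrightarrow> B \<noteq> {} \<Longrightarrow>
      \<exists>y\<in>H. nbrs A y \<noteq> {} \<and> nbrs B y \<noteq> {}"
    by (rule connected_subset[OF finite_level[OF assms(1)] big two]) (rule that)
  obtain x where "x \<in> H" using H(3) by blast
  have "card (nbrs H x) \<le> card H"
    using finite_subset[OF H(1) finite_level[OF assms(1)]] by (intro card_mono) (auto simp: nbrs_def)
  then have "2 \<le> card H" using H(2)[OF \<open>x \<in> H\<close>] by linarith
  then obtain h A B where h: "1 \<le> h" "h \<le> i"
    and AB: "A \<union> B = H" "A \<inter> B = {}" "A \<noteq> {}" "B \<noteq> {}"
    and cyc: "\<And>t. joined ?L A B t \<Longrightarrow> \<exists>ys. cyc ys \<and> length ys = t + 2 * h"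
    using level_split[OF assms(1) H(1)] by blast
  obtain y where y: "y \<in> H" "nbrs A y \<noteq> {}" "nbrs B y \<noteq> {}" using conn[OF AB] by blast
  have "joined (A \<union> B) A B (l - 2 * h)"
  proof (rule joined_within[of A B ?m y])
    show "?m \<le> card (nbrs (A \<union> B) x)" if "x \<in> A \<union> B" for x using H(2) that AB(1) by metis
  qed (use AB y h assms(3) in auto)
  then have "joined ?L A B (l - 2 * h)" by (rule joined_mono) (use AB(1) H(1) in blast)
  then obtain ys where "cyc ys" "length ys = l - 2 * h + 2 * h" using cyc by blast
  moreover have "l - 2 * h + 2 * h = l" using h assms(3) by linarith
  ultimately show ?thesis by metis
qed

text \<open>The same scheme for a pair. The degree \<open>l + 2 * alpha V + 5\<close> covers both
  the pigeonhole at \<open>y\<close> and the length of the greedy path.\<close>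

lemma cycle_in_dense_pair:
  assumes v: "v \<in> V" and X: "X \<subseteq> level v j" "X \<noteq> {}" and Y: "Y \<subseteq> level v j \<union> level v (Suc j)"
    and deg: "bideg (l + 2 * alpha V + 5) X Y" and l: "2 * j + 2 \<le> l"
  shows "\<exists>xs. cyc xs \<and> length xs = l"
proof -
  let ?m = "l + 2 * alpha V + 5" and ?L = "level v j \<union> level v (Suc j)"
  have finX: "finite X" using finite_subset[OF X(1) finite_level[OF v]] .
  obtain X' Y' where X': "X' \<subseteq> X" "X' \<noteq> {}" and Y': "Y' \<subseteq> ?L" and deg': "bideg ?m X' Y'"
    and conn: "\<And>A B. A \<union> B = X' \<Longrightarrow> A \<inter> B = {} \<Longrightarrow> A \<noteq> {} \<Longrightarrow> B \<noteq> {} \<Longrightarrow>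
      \<exists>y\<in>Y'. nbrs A y \<noteq> {} \<and> nbrs B y \<noteq> {}"
    using connected_subpair[OF finX Y X(2) deg] by metis
  have finX': "finite X'" and X'L: "X' \<subseteq> level v j" using X' X finX finite_subset by auto
  obtain x where "x \<in> X'" using X'(2) by blast
  then have "?m \<le> card (nbrs Y' x)" using deg' by (simp add: bideg_def)
  then have "nbrs Y' x \<noteq> {}" by auto
  then obtain y where "y \<in> Y'" by (auto simp: nbrs_def)
  then have "?m \<le> card (nbrs X' y)" using deg' by (simp add: bideg_def)
  moreover have "card (nbrs X' y) \<le> card X'"
    using finX' by (intro card_mono) (auto simp: nbrs_def)
  ultimately have "2 \<le> card X'" by linarith
  then obtain h A B where h: "1 \<le> h" "h \<le> j"
    and AB: "A \<union> B = X'" "A \<inter> B = {}" "A \<noteq> {}" "B \<noteq> {}"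
    and cyc: "\<And>t. joined ?L A B t \<Longrightarrow> \<exists>ys. cyc ys \<and> length ys = t + 2 * h"
    using level_split[OF v X'L] by blast
  obtain y where y: "y \<in> Y'" "nbrs A y \<noteq> {}" "nbrs B y \<noteq> {}" using conn[OF AB] by blast
  have "joined (A \<union> B \<union> Y') A B (l - 2 * h)"
  proof (rule joined_bipartite[of A B ?m Y' y])
    show "?m \<le> card (nbrs Y' x)" if "x \<in> A \<union> B" for x
      using deg' that AB(1) unfolding bideg_def by metis
    show "?m \<le> card (nbrs (A \<union> B) y)" if "y \<in> Y'" for y
      using deg' that AB(1) unfolding bideg_def by metis
    show "A \<union> B \<subseteq> V" using AB(1) X'L level_subset[OF v] by blast
  qed (use AB(2) y h l in auto)
  then have "joined ?L A B (l - 2 * h)" by (rule joined_mono) (use AB(1) X'L Y' in blast)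
  then obtain ys where "cyc ys" "length ys = l - 2 * h + 2 * h" using cyc by blast
  moreover have "l - 2 * h + 2 * h = l" using h l by linarith
  ultimately show ?thesis by metis
qed

text \<open>Length 3 is treated apart: two tree edges and a path of at least two edges give length
  at least 4.\<close>

lemma triangle:
  assumes "x \<in> V" "alpha V < card (nbrs V x)"
  shows "\<exists>xs. cyc xs \<and> length xs = 3"
proof -
  obtain u w where "u \<in> nbrs V x" "w \<in> nbrs V x" "adj u w"
    using exists_edge[OF finite_V, of "nbrs V x"] assms(2) by (auto simp: nbrs_def)
  then have "cyc [x, u, w]"
    using assms(1) adj_irrefl adj_sym[of x w] by (auto simp: cyc_def path_def nbrs_def)
  then show ?thesis by (intro exI[of _ "[x, u, w]"]) simp
qed

text \<open>Level \<open>Suc i\<close> sends at least \<open>d\<close> edges per vertex into three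
  levels of total size at most four times its own. If all three pairs were sparse, the count would
  be at most \<open>7 * m\<close> per vertex.\<close>

lemma level_sparse_step:
  assumes v: "v \<in> V" and mindeg: "\<And>x. x \<in> V \<Longrightarrow> d \<le> card (nbrs V x)"
    and pos: "level v (Suc i) \<noteq> {}"
    and small: "card (level v i) \<le> card (level v (Suc i))"
      "card (level v (Suc (Suc i))) \<le> 2 * card (level v (Suc i))"
    and d: "7 * m < d"
  obtains j X Y where "i \<le> j" "j \<le> Suc i" "X \<subseteq> level v j" "X \<noteq> {}"
    "Y \<subseteq> level v j \<union> level v (Suc j)" "bideg m X Y"
proof -
  let ?M = "level v (Suc i)" and ?P = "level v i" and ?N = "level v (Suc (Suc i))"
  have fin: "finite ?M" "finite ?P" "finite ?N" using finite_level[OF v] by auto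
  let ?e = "\<lambda>W. \<Sum>x\<in>?M. card (nbrs W x)"
  have "d * card ?M \<le> (\<Sum>x\<in>?M. card (nbrs V x))"
    using sum_bounded_below[of ?M d "\<lambda>x. card (nbrs V x)"] mindeg level_subset[OF v]
    by (auto simp: mult.commute)
  also have "\<dots> \<le> (\<Sum>x\<in>?M. card (nbrs ?P x) + card (nbrs ?M x) + card (nbrs ?N x))"
  proof (rule sum_mono)
    fix x assume x: "x \<in> ?M"
    show "card (nbrs V x) \<le> card (nbrs ?P x) + card (nbrs ?M x) + card (nbrs ?N x)"
      using card_Un_le[of "nbrs ?P x \<union> nbrs ?M x" "nbrs ?N x"] card_Un_le[of "nbrs ?P x" "nbrs ?M x"]
      unfolding nbrs_level[OF x] by linarith
  qed
  finally have sum: "d * card ?M \<le> ?e ?P + ?e ?M + ?e ?N" by (simp add: sum.distrib)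
  have big: "\<exists>W\<in>{?P, ?M, ?N}. m * (card ?M + card W) < ?e W"
  proof (rule ccontr)
    assume "\<not> ?thesis"
    then have "?e ?P + ?e ?M + ?e ?N \<le>
        m * (card ?M + card ?P) + m * (card ?M + card ?M) + m * (card ?M + card ?N)"
      by (intro add_mono) (auto simp: not_less)
    also have "\<dots> = m * (4 * card ?M + card ?P + card ?N)" by (simp add: algebra_simps)
    also have "\<dots> \<le> m * (7 * card ?M)" using small by (intro mult_le_mono2) linarith
    also have "\<dots> = (7 * m) * card ?M" by simp
    also have "\<dots> < d * card ?M" using d pos fin(1) by (intro mult_strict_right_mono) (auto simp: card_gt_0_iff)
    finally show False using sum by simp
  qed
  then consider "m * (card ?M + card ?P) < ?e ?P" | W where "W = ?M \<or> W = ?N"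
    "m * (card ?M + card W) < ?e W" by auto
  then show thesis
  proof cases
    case 1
    \<comment> \<open>Exchanging the sides puts \<open>X\<close> into the level nearer to
      \<open>v\<close>, as the conclusion demands.\<close>
    then have "m * (card ?P + card ?M) < (\<Sum>x\<in>?P. card (nbrs ?M x))"
      using fin by (simp add: sum_nbrs_swap[of ?P] add.commute)
    from dense_subpair[OF fin(2) fin(1) this]
    obtain X Y where "X \<subseteq> ?P" "Y \<subseteq> ?M" "X \<noteq> {}" "bideg m X Y" by blast
    then show thesis using that[of i X Y] by auto
  next
    case 2
    then have "finite W" using fin by auto
    from dense_subpair[OF fin(1) this 2(2)]
    obtain X Y where "X \<subseteq> ?M" "Y \<subseteq> W" "X \<noteq> {}" "bideg m X Y" by blast
    then show thesis using that[of "Suc i" X Y] 2(1) by auto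
  qed
qed

theorem cycle_lengths:
  assumes "V \<noteq> {}" and mindeg: "\<And>x. x \<in> V \<Longrightarrow> d \<le> card (nbrs V x)"
    and d: "300 * alpha V \<le> d" "81 * l \<le> d" and l: "3 \<le> l"
  shows "\<exists>xs. cyc xs \<and> length xs = l"
proof -
  obtain v where v: "v \<in> V" using assms(1) by blast
  have a: "1 \<le> alpha V" using alpha_pos[OF finite_V v] by simp
  let ?n = "\<lambda>i. card (level v i)"
  \<comment> \<open>Both predicates at \<open>i\<close> concern level \<open>Suc i\<close>, since
    level 0 is a single vertex.\<close>
  let ?big = "\<lambda>i. (l + 5) * alpha V < ?n (Suc i)" and ?slow = "\<lambda>i. ?n (Suc (Suc i)) < 2 * ?n (Suc i)"
  have n1: "d \<le> ?n (Suc 0)" using mindeg[OF v] by (simp add: level_1)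
  have growth: "2 ^ i * d \<le> ?n (Suc i)" if "\<forall>k<i. \<not> ?slow k" for i
    using that
  proof (induction i)
    case (Suc i)
    then have "2 ^ i * d \<le> ?n (Suc i)" "2 * ?n (Suc i) \<le> ?n (Suc (Suc i))" by (auto simp: not_less)
    then show ?case by simp
  qed (use n1 in simp)
  \<comment> \<open>A linear bound is enough to keep the chosen level far below
    \<open>l / 2\<close>.\<close>
  have growth': "300 * Suc i * alpha V \<le> ?n (Suc i)" if "\<forall>k<i. \<not> ?slow k" for i
  proof -
    have "Suc i \<le> 2 ^ i" by (simp add: Suc_leI less_exp)
    then have "Suc i * (300 * alpha V) \<le> 2 ^ i * d" using d(1) by (intro mult_le_mono) auto
    then show ?thesis using growth[OF that] by (simp add: algebra_simps)
  qed
  have "\<exists>i. ?big i \<or> ?slow i"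
  proof (rule ccontr)
    assume no: "\<not> ?thesis"
    have "300 * Suc (l + 5) * alpha V \<le> ?n (Suc (l + 5))" using no by (intro growth') auto
    moreover have "(l + 5) * alpha V < 300 * Suc (l + 5) * alpha V"
      using a by (intro mult_strict_right_mono) auto
    ultimately show False using no by (meson not_less order_trans leD)
  qed
  then obtain i where i: "?big i \<or> ?slow i" and first: "\<And>k. k < i \<Longrightarrow> \<not> ?big k \<and> \<not> ?slow k"
    using exists_least_iff[of "\<lambda>i. ?big i \<or> ?slow i"] by blast
  \<comment> \<open>A level that is not big caps its own index: its size is at least
    \<open>300 * Suc k * alpha V\<close> and at most \<open>(l + 5) * alpha V\<close>.\<close>
  have bound: "300 * Suc k \<le> l + 5" if "\<not> ?big k" "k \<le> i" for k
  proof -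
    have "300 * Suc k * alpha V \<le> (l + 5) * alpha V"
      using growth'[of k] first that by (meson less_le_trans not_less order_trans)
    then show ?thesis using a by (simp only: mult_le_cancel2)
  qed
  consider "l = 3" | "4 \<le> l" "?big i" | "\<not> ?big i" using l by linarith
  then show ?thesis
  proof cases
    case 1
    have "alpha V < card (nbrs V v)" using mindeg[OF v] d(1) a by linarith
    then show ?thesis using triangle[OF v] 1 by simp
  next
    case 2
    \<comment> \<open>For \<open>i = 0\<close> this is \<open>4 \<le> l\<close>; otherwise the
      preceding level is not big, which bounds \<open>i\<close>.\<close>
    have "2 * Suc i + 2 \<le> l"
    proof (cases i)
      case (Suc k)
      then have "300 * Suc k \<le> l + 5" using first[of k] by (intro bound) auto
      then show ?thesis unfolding Suc by simp
    qed (use 2 in simp)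
    then show ?thesis using cycle_in_large_level[OF v 2(2)] by simp
  next
    case 3
    then have slow: "?slow i" and bnd: "300 * Suc i \<le> l + 5" using i bound[of i] by auto
    have "level v (Suc i) \<noteq> {}" using slow by auto
    moreover have "?n i \<le> ?n (Suc i)"
    proof (cases i)
      case 0
      then show ?thesis using n1 d a by (simp add: level_0)
    next
      case (Suc k)
      then show ?thesis using first[of k] by simp
    qed
    moreover have "7 * (l + 2 * alpha V + 5) < d"
    proof -
      \<comment> \<open>As \<open>1 \<le> alpha V\<close>, the left side is at most
        \<open>7 * l + 49 * alpha V\<close>, the mean of \<open>14 * l\<close> and
        \<open>98 * alpha V\<close>.\<close>
      have "98 * alpha V < d" "14 * l \<le> d" using d a by linarith+
      then show ?thesis using a by (simp add: add_mult_distrib2)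
    qed
    ultimately obtain j X Y where j: "j \<le> Suc i" and "X \<subseteq> level v j" "X \<noteq> {}"
      "Y \<subseteq> level v j \<union> level v (Suc j)" "bideg (l + 2 * alpha V + 5) X Y"
      using level_sparse_step[OF v mindeg, of i "l + 2 * alpha V + 5"] slow
      by (metis less_imp_le)
    moreover have "2 * j + 2 \<le> l" using j bnd by simp
    ultimately show ?thesis using cycle_in_dense_pair[OF v] by blast
  qed
qed

end

section \<open>From vertex lists to cycles of the digraph\<close>

lemma pcas_zip:
  "xs \<noteq> [] \<Longrightarrow> pcas (hd xs) (zip xs (tl xs @ [z])) z"
proof (induction xs)
  case (Cons x xs)
  then show ?case by (cases xs) auto
qed simp

lemma zip_successively:
  "xs \<noteq> [] \<Longrightarrow> successively P xs \<Longrightarrow> P (last xs) z \<Longrightarrow> (u, w) \<in> set (zip xs (tl xs @ [z])) \<Longrightarrow> P u w"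
proof (induction xs)
  case (Cons x xs)
  then show ?case by (cases xs) auto
qed simp

theorem theorem1p3:
  fixes G :: "'a pair_pre_digraph"
  assumes "pair_graph G"
    and "pverts G \<noteq> {}"
    and "min_degree G \<ge> 300 * independence_number G"
  shows "\<forall>l::nat. 3 \<le> l \<and> real l \<le> real (min_degree G) / 81 \<longrightarrow>
           (\<exists>p. pre_digraph.cycle (with_proj G) p \<and> length p = l)"
proof (intro allI impI)
  fix l :: nat assume l: "3 \<le> l \<and> real l \<le> real (min_degree G) / 81"
  interpret G: pair_graph G by fact
  interpret A: adjacency_graph "pverts G" "\<lambda>u v. (u, v) \<in> parcs G"
    using G.pair_finite_verts G.in_arcsD1 G.arcs_symmetric G.no_loops' by unfold_locales blast+
  have alpha: "A.alpha (pverts G) = independence_number G"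
    unfolding A.alpha_def independence_number_def independent_set_def A.indep_def by simp
  have deg: "min_degree G \<le> card (A.nbrs (pverts G) x)" if "x \<in> pverts G" for x
  proof -
    have "out_arcs (with_proj G) x = Pair x ` A.nbrs (pverts G) x"
      using G.in_arcsD2 by (auto simp: A.nbrs_def)
    then have "out_degree (with_proj G) x = card (A.nbrs (pverts G) x)"
      unfolding out_degree_def by (simp add: card_image inj_on_def)
    then show ?thesis
      unfolding min_degree_def using that G.pair_finite_verts by (metis Min_le finite_imageI imageI)
  qed
  have "real (81 * l) \<le> real (min_degree G)" using l by simp
  then have "81 * l \<le> min_degree G" by (simp only: of_nat_le_iff)
  then obtain xs where xs: "A.cyc xs" "length xs = l"
    using A.cycle_lengths[OF assms(2) deg, of l] assms(3) l alpha by auto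
  \<comment> \<open>Each vertex is paired with its successor and the last one with the first, giving
    the arcs of the closed walk.\<close>
  let ?p = "zip xs (tl xs @ [hd xs])"
  have ne: "xs \<noteq> []" and dist: "distinct xs" and sub: "set xs \<subseteq> pverts G"
    and suc: "successively (\<lambda>u v. (u, v) \<in> parcs G) xs" "(last xs, hd xs) \<in> parcs G"
    using xs by (auto simp: A.cyc_def A.path_def)
  have len: "length ?p = l" using xs(2) ne by (cases xs) auto
  have cas: "pcas (hd xs) ?p (hd xs)" by (rule pcas_zip[OF ne])
  have "set ?p \<subseteq> parcs G" using zip_successively[OF ne suc] by auto
  then have "G.awalk (hd xs) ?p (hd xs)" using ne sub cas unfolding G.awalk_def by (auto simp: subset_iff)
  moreover have "?p \<noteq> []" using len l by auto
  \<comment> \<open>After the start, the walk visits the heads of its arcs, a rotation of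
    \<open>xs\<close>, hence distinct.\<close>
  moreover have "tl (pawalk_verts (hd xs) ?p) = tl xs @ [hd xs]"
  proof -
    have "map snd ?p = tl xs @ [hd xs]" using ne by (cases xs) auto
    then show ?thesis using G.awalk_verts_conv'[OF cas] \<open>?p \<noteq> []\<close> by simp
  qed
  moreover have "distinct (tl xs @ [hd xs])" using dist ne by (cases xs) auto
  ultimately have "G.cycle ?p" unfolding G.cycle_def by (metis)
  then show "\<exists>p. pre_digraph.cycle (with_proj G) p \<and> length p = l" using len by blast
qed

end
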